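(* For every integer $n\geq 2$, the Ramsey number $R(n)$ satisfies $$R(n)\leq 2^{2n-3}.$$
   Context: Graphs are finite, simple and unoriented. For a natural number $n\ge 1$, the $n$-th Ramsey number $R(n)$ is the smallest natural number such that every graph $G$ with at least $R(n)$ vertices contains either a complete graph on $n$ vertices (that is, $n$ pairwise adjacent vertices) or $n$ pairwise non-adjacent vertices. *)

theory Defs
  imports "HOL-Library.Ramsey"
begin

definition finite_simple_graph :: "'a set \<Rightarrow> 'a set set \<Rightarrow> bool" where
  "finite_simple_graph V E \<longleftrightarrow> finite V \<and> E \<subseteq> nsets V 2"

(* Vertices are taken in nat so that the definition does not depend on a type parameter;
   every finite graph is isomorphic to one of these, see ramsey_bound_transfer below. *)
definition ramsey_bound :: "nat \<Rightarrow> nat \<Rightarrow> bool" where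
  "ramsey_bound n r \<longleftrightarrow>
     (\<forall>(V :: nat set) E. finite_simple_graph V E \<and> r \<le> card V \<longrightarrow>
        (\<exists>K \<subseteq> V. card K = n \<and> clique K E) \<or> (\<exists>K \<subseteq> V. card K = n \<and> indep K E))"

definition ramsey_number :: "nat \<Rightarrow> nat" where
  "ramsey_number n = (LEAST r. ramsey_bound n r)"

lemma ramsey_bound_exists: "\<exists>r. ramsey_bound n r"
proof -
  obtain r where r: "\<And>(V :: nat set) E. finite V \<Longrightarrow> card V \<ge> r \<Longrightarrow>
      \<exists>R \<subseteq> V. card R = n \<and> clique R E \<or> card R = n \<and> indep R E"
    using ramsey2[of n n] by blast
  have "ramsey_bound n r"
    unfolding ramsey_bound_def finite_simple_graph_def using r by blast
  then show ?thesis ..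
qed

lemma ramsey_bound_ramsey_number: "ramsey_bound n (ramsey_number n)"
  unfolding ramsey_number_def using ramsey_bound_exists by (rule LeastI_ex)

lemma ramsey_bound_transfer:
  fixes V :: "'a set"
  assumes "ramsey_bound n r" and "finite_simple_graph V E" and "r \<le> card V"
  shows "(\<exists>K \<subseteq> V. card K = n \<and> clique K E) \<or> (\<exists>K \<subseteq> V. card K = n \<and> indep K E)"
proof -
  have "finite V"
    using assms(2) by (simp add: finite_simple_graph_def)
  then obtain f where f: "bij_betw f {0..<card V} V"
    using ex_bij_betw_nat_finite by blast
  define W where "W = {0..<card V}"
  define F where "F = {e \<in> nsets W 2. f ` e \<in> E}"
  have inj: "inj_on f W" and im: "f ` W = V"
    using f by (auto simp: bij_betw_def W_def)
  have "finite_simple_graph W F" "r \<le> card W"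
    using assms(3) by (auto simp: finite_simple_graph_def W_def F_def)
  then obtain K where K: "K \<subseteq> W" "card K = n" "clique K F \<or> indep K F"
    using assms(1) unfolding ramsey_bound_def by blast
  have edge: "{f v, f w} \<in> E \<longleftrightarrow> {v, w} \<in> F" if "v \<in> K" "w \<in> K" "v \<noteq> w" for v w
    using that K(1) by (auto simp: F_def)
  have "f ` K \<subseteq> V" "card (f ` K) = n"
    using K inj im by (auto simp: card_image inj_on_subset)
  moreover have "clique (f ` K) E \<or> indep (f ` K) E"
    using K(3)
  proof
    assume "clique K F"
    then have "clique (f ` K) E"
      unfolding clique_def by (metis edge imageE)
    then show ?thesis ..
  next
    assume "indep K F"
    then have "indep (f ` K) E"
      unfolding indep_def by (metis edge imageE)
    then show ?thesis ..
  qed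
  ultimately show ?thesis by blast
qed

end

theory Submission
  imports Defs
begin

text \<open>
  The classical halving argument of Erdos and Szekeres gives the bound, in a form that separates
  the two target sizes: a graph with at least \<open>2 ^ (a + b - 1)\<close> vertices contains a clique of
  size \<open>a + 1\<close> or an independent set of size \<open>b + 1\<close>. Remove a vertex \<open>v\<close>: the remaining
  \<open>2 ^ (a + b - 1) - 1\<close> or more vertices are split into neighbours and non-neighbours of \<open>v\<close>, and
  one of the two parts has at least \<open>2 ^ (a + b - 2)\<close> elements. Induction applies to that part,
  with \<open>a\<close> lowered among the neighbours or \<open>b\<close> lowered among the non-neighbours, and \<open>v\<close> extends
  whichever clique or independent set was asked to be one smaller.

  Removing \<open>v\<close> costs nothing in the halving, because the larger part of a set of \<open>2 * m - 1\<close>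
  elements still has \<open>m\<close> of them. The exponent is \<open>a + b - 1\<close> rather than \<open>a + b\<close> because a
  single vertex is both a clique and an independent set: once \<open>a + b = 1\<close>, one vertex suffices,
  whichever of the two targets has size 1. Taking \<open>a = b = n - 1\<close> yields the exponent
  \<open>2 * n - 3\<close>.
\<close>

text \<open>
  The target sizes are \<open>Suc a\<close> and \<open>Suc b\<close> so that the base case \<open>a = 0 \<or> b = 0\<close> asks for a
  single vertex only; at \<open>a = b = 0\<close> truncated subtraction turns the size condition into
  \<open>1 \<le> card V\<close>, which is what that case requires.
\<close>

lemma clique_or_indep_of_card_ge_power:
  assumes "finite V" and "2 ^ (a + b - 1) \<le> card V"
  shows "\<exists>K \<subseteq> V. card K = Suc a \<and> clique K E \<or> card K = Suc b \<and> indep K E"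
  using assms
proof (induction "a + b" arbitrary: a b V rule: less_induct)
  case less
  have "0 < card V"
    using less.prems(2) by (metis not_le power_eq_0_iff bot_nat_0.not_eq_extremum le_zero_eq zero_neq_numeral)
  then obtain v where v: "v \<in> V"
    by fastforce
  show ?case
  proof (cases "a = 0 \<or> b = 0")
    case True
    have "{v} \<subseteq> V" "card {v} = Suc 0" "clique {v} E" "indep {v} E"
      using v by (auto simp: clique_def indep_def)
    with True show ?thesis by metis
  next
    case False
    then obtain a' b' where ab: "a = Suc a'" "b = Suc b'"
      by (meson not0_implies_Suc)
    define N where "N = {w \<in> V - {v}. {v, w} \<in> E}"
    define M where "M = {w \<in> V - {v}. {v, w} \<notin> E}"
    have fin: "finite N" "finite M" and sub: "N \<subseteq> V - {v}" "M \<subseteq> V - {v}"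
      using less.prems(1) by (auto simp: N_def M_def)
    have "N \<union> M = V - {v}" "N \<inter> M = {}"
      by (auto simp: N_def M_def)
    then have "card N + card M = card V - 1"
      using fin v less.prems(1) by (metis card_Un_disjoint card_Diff_singleton)
    then have "2 ^ (a' + b') \<le> card N \<or> 2 ^ (a' + b') \<le> card M"
      using less.prems(2) ab by auto
    then show ?thesis
    proof
      assume "2 ^ (a' + b') \<le> card N"
      then obtain K where K: "K \<subseteq> N" "card K = a \<and> clique K E \<or> card K = Suc b \<and> indep K E"
        using less.hyps[of a' b N] fin ab by auto
      have "finite K" "v \<notin> K"
        using K(1) fin sub by (auto intro: finite_subset)
      have "clique (insert v K) E" if "clique K E"
        using that K(1) by (auto simp: clique_def N_def insert_commute)
      then show ?thesis
        using K \<open>finite K\<close> \<open>v \<notin> K\<close> v sub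
        by (metis card_insert_disjoint insert_subset subset_Diff_insert subset_trans Diff_subset)
    next
      assume "2 ^ (a' + b') \<le> card M"
      then obtain K where K: "K \<subseteq> M" "card K = Suc a \<and> clique K E \<or> card K = b \<and> indep K E"
        using less.hyps[of a b' M] fin ab by auto
      have "finite K" "v \<notin> K"
        using K(1) fin sub by (auto intro: finite_subset)
      have "indep (insert v K) E" if "indep K E"
        using that K(1) by (auto simp: indep_def M_def insert_commute)
      then show ?thesis
        using K \<open>finite K\<close> \<open>v \<notin> K\<close> v sub
        by (metis card_insert_disjoint insert_subset subset_Diff_insert subset_trans Diff_subset)
    qed
  qed
qed

theorem theorem1p1:
  fixes n :: nat
  assumes "n \<ge> 2"
  shows "ramsey_number n \<le> 2 ^ (2 * n - 3)"
proof -
  have n: "Suc (n - 1) = n" "(n - 1) + (n - 1) - 1 = 2 * n - 3"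
    using assms by auto
  have "ramsey_bound n (2 ^ (2 * n - 3))"
    unfolding ramsey_bound_def finite_simple_graph_def
    using clique_or_indep_of_card_ge_power[where a = "n - 1" and b = "n - 1", unfolded n] by blast
  then show ?thesis
    unfolding ramsey_number_def by (rule Least_le)
qed

end
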